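(* Let $\rho>0$, $p$, $\mathbf u$ and $\mathbf b$ be smooth fields on $\Omega\times I$ (density, pressure, velocity, body force) satisfying the continuity equation $\partial_t\rho+\mathbf u\cdot\nabla\rho=-\rho\,\nabla\cdot\mathbf u$ and the momentum equation $\rho(\partial_t\mathbf u+(\mathbf u\cdot\nabla)\mathbf u)=\nabla\cdot\underline{\underline{\tau}}+\rho\,\mathbf b$ in $\Omega$ for all $t\in I$, where $\underline{\underline{\tau}}$ is the (smooth) Cauchy stress tensor. Let $\langle\rho_h\rangle$, $\widetilde{\mathbf u}_h$, $\widetilde{\mathbf b}_h$ be the corresponding filtered fields on $U_h\times I$ and let $\frac{d}{dt}=\frac{\partial}{\partial t}+\widetilde{\mathbf u}_h\cdot\nabla$. Then for all $\mathbf r\in U_h$ and $t\in I$, $$\langle\rho_h(\mathbf r)\rangle\frac{d}{dt}\widetilde{\mathbf u}_h(\mathbf r)=-\int_{\Omega_h(\mathbf r)}\rho(\mathbf r')\Big[\big(\widetilde{\mathbf u}_h(\mathbf r)-\mathbf u(\mathbf r')\big)\otimes\big(\widetilde{\mathbf u}_h(\mathbf r)-\mathbf u(\mathbf r')\big)\Big]\cdot\nabla w_h(\mathbf r-\mathbf r')\,d^n\mathbf r'+\langle\nabla\cdot\underline{\underline{\tau}},w_h\rangle(\mathbf r)+\langle\rho_h(\mathbf r)\rangle\,\widetilde{\mathbf b}_h(\mathbf r).$$ Here the dependence of all fields on $t$ is suppressed.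
   Context: Let $\Omega\subseteq\mathbb R^n$ be an open set (the fluid domain), $I\subseteq\mathbb R$ an open time interval, $h>0$ a fixed filter length and $\kappa>0$ a fixed constant. The filter (kernel) $w_h\in C_c^\infty(\mathbb R^n)$ is real-valued, satisfies $w_h\ge 0$ and $\int_{\mathbb R^n}w_h=1$, and is supported in the closed ball of radius $\kappa h$ about $0$. For a point $\mathbf r$, the test space is $\Omega_h(\mathbf r)=\{\mathbf r':\|\mathbf r-\mathbf r'\|\le\kappa h\}$; set $U_h=\{\mathbf r\in\Omega:\Omega_h(\mathbf r)\subset\Omega\}$, the open set of points whose test space lies within the fluid domain. For $\mathbf r\in U_h$ the filtered density, and the filtered (density-weighted) velocity and body force, are defined by $$\langle\rho_h(\mathbf r)\rangle=\int_{\Omega_h(\mathbf r)}\rho(\mathbf r')w_h(\mathbf r-\mathbf r')\,d^n\mathbf r',\qquad \langle\rho_h(\mathbf r)\rangle\,\widetilde{\mathbf u}_h(\mathbf r)=\int_{\Omega_h(\mathbf r)}\rho(\mathbf r')\mathbf u(\mathbf r')w_h(\mathbf r-\mathbf r')\,d^n\mathbf r',$$ $$\langle\rho_h(\mathbf r)\rangle\,\widetilde{\mathbf b}_h(\mathbf r)=\int_{\Omega_h(\mathbf r)}\rho(\mathbf r')\mathbf b(\mathbf r')w_h(\mathbf r-\mathbf r')\,d^n\mathbf r',$$ and the filtered stress divergence is $$\langle\nabla\cdot\underline{\underline{\tau}},w_h\rangle(\mathbf r)=\int_{\Omega_h(\mathbf r)}\big(\nabla'\cdot\underline{\underline{\tau}}(\mathbf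 r')\big)w_h(\mathbf r-\mathbf r')\,d^n\mathbf r',$$ where $\nabla'$ acts on $\mathbf r'$. For a Newtonian fluid with kinematic viscosity $\nu$ the Cauchy stress tensor is $\underline{\underline{\tau}}=-p\,\underline{\underline{1}}+\nu\rho\big(\nabla\mathbf u+\nabla\mathbf u^{\mathrm T}-\tfrac{2}{n}(\nabla\cdot\mathbf u)\underline{\underline{1}}\big)$, with $\underline{\underline{1}}$ the identity tensor; it is symmetric and its divergence is $(\nabla\cdot\underline{\underline{\tau}})_i=\sum_j\partial_j\tau_{ij}$. In the integral $\nabla w_h(\mathbf r-\mathbf r')$ denotes the gradient with respect to $\mathbf r$ of $w_h(\mathbf r-\mathbf r')$, and $(\mathbf a\otimes\mathbf c)\cdot\mathbf d=\mathbf a\,(\mathbf c\cdot\mathbf d)$. *)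

theory Defs
  imports "HOL-Analysis.Analysis"
begin

text \<open>
  \<open>Ck_on k S f\<close> is meant for open \<open>S\<close> only: all derivatives are taken with respect to
  full neighbourhoods.
\<close>

fun Ck_on :: "nat \<Rightarrow> 'a::euclidean_space set \<Rightarrow> ('a \<Rightarrow> 'b::real_normed_vector) \<Rightarrow> bool" where
  "Ck_on 0 S f \<longleftrightarrow> continuous_on S f"
| "Ck_on (Suc k) S f \<longleftrightarrow>
     (\<forall>x\<in>S. f differentiable (at x)) \<and>
     (\<forall>v. Ck_on k S (\<lambda>x. frechet_derivative f (at x) v))"

definition smooth_on :: "'a::euclidean_space set \<Rightarrow> ('a \<Rightarrow> 'b::real_normed_vector) \<Rightarrow> bool" where
  "smooth_on S f \<longleftrightarrow> (\<forall>k. Ck_on k S f)"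

definition partial_deriv :: "'n::finite \<Rightarrow> (real^'n \<Rightarrow> 'b::real_normed_vector) \<Rightarrow> real^'n \<Rightarrow> 'b" where
  "partial_deriv j f x = frechet_derivative f (at x) (axis j 1)"

definition grad :: "(real^'n \<Rightarrow> real) \<Rightarrow> real^'n \<Rightarrow> real^'n" where
  "grad f x = (\<chi> j. partial_deriv j f x)"

definition velocity_grad :: "(real^'n \<Rightarrow> real^'n) \<Rightarrow> real^'n \<Rightarrow> real^'n^'n" where
  "velocity_grad u x = (\<chi> i j. partial_deriv i (\<lambda>y. u y $ j) x)"

definition divergence :: "(real^'n \<Rightarrow> real^'n) \<Rightarrow> real^'n \<Rightarrow> real" where
  "divergence u x = (\<Sum>j\<in>UNIV. partial_deriv j (\<lambda>y. u y $ j) x)"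

definition tensor_divergence :: "(real^'n \<Rightarrow> real^'n^'n) \<Rightarrow> real^'n \<Rightarrow> real^'n" where
  "tensor_divergence T x = (\<chi> i. \<Sum>j\<in>UNIV. partial_deriv j (\<lambda>y. T y $ i $ j) x)"

text \<open>\<open>advect v f\<close> is \<open>(v \<cdot> \<nabla>) f\<close>.\<close>

definition advect :: "real^'n \<Rightarrow> (real^'n \<Rightarrow> 'b::real_normed_vector) \<Rightarrow> real^'n \<Rightarrow> 'b" where
  "advect v f x = (\<Sum>j\<in>UNIV. (v $ j) *\<^sub>R partial_deriv j f x)"

text \<open>Time-dependent fields take the time first, so that \<open>f t\<close> is the spatial field at time \<open>t\<close>.\<close>

definition time_deriv :: "(real \<Rightarrow> real^'n \<Rightarrow> 'b::real_normed_vector) \<Rightarrow> real \<Rightarrow> real^'n \<Rightarrow> 'b" where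
  "time_deriv f t x = vector_derivative (\<lambda>s. f s x) (at t)"

definition material_deriv ::
  "(real \<Rightarrow> real^'n \<Rightarrow> real^'n) \<Rightarrow> (real \<Rightarrow> real^'n \<Rightarrow> 'b::real_normed_vector) \<Rightarrow> real \<Rightarrow> real^'n \<Rightarrow> 'b" where
  "material_deriv v f t x = time_deriv f t x + advect (v t x) (f t) x"

definition outer :: "real^'n \<Rightarrow> real^'n \<Rightarrow> real^'n^'n" where
  "outer a c = (\<chi> i j. a $ i * c $ j)"

lemma outer_mult_vec: "outer a c *v d = (c \<bullet> d) *\<^sub>R a"
  by (simp add: outer_def vec_eq_iff matrix_vector_mult_def inner_vec_def sum_distrib_left
      mult_ac)

definition newtonian_stress ::
  "(real^'n \<Rightarrow> real) \<Rightarrow> (real^'n \<Rightarrow> real) \<Rightarrow> (real^'n \<Rightarrow> real) \<Rightarrow> (real^'n \<Rightarrow> real^'n) \<Rightarrow> real^'n \<Rightarrow> real^'n^'n"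
where
  "newtonian_stress \<nu> p \<rho> u x =
     - (p x *\<^sub>R mat 1) + (\<nu> x * \<rho> x) *\<^sub>R
       (velocity_grad u x + transpose (velocity_grad u x)
         - (2 / real CARD('n) * divergence u x) *\<^sub>R mat 1)"

definition test_space :: "real \<Rightarrow> real \<Rightarrow> real^'n \<Rightarrow> (real^'n) set" where
  "test_space \<kappa> h r = {r'. norm (r - r') \<le> \<kappa> * h}"

definition resolved_domain :: "real \<Rightarrow> real \<Rightarrow> (real^'n) set \<Rightarrow> (real^'n) set" where
  "resolved_domain \<kappa> h \<Omega> = {r \<in> \<Omega>. test_space \<kappa> h r \<subseteq> \<Omega>}"

definition filtered ::
  "real \<Rightarrow> real \<Rightarrow> (real^'n \<Rightarrow> real) \<Rightarrow> (real^'n \<Rightarrow> 'b::{banach, second_countable_topology})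
    \<Rightarrow> real^'n \<Rightarrow> 'b" where
  "filtered \<kappa> h w f r = (LINT r':test_space \<kappa> h r|lborel. w (r - r') *\<^sub>R f r')"

text \<open>
  The density-weighted field is determined by
  \<open>filtered \<kappa> h w \<rho> r *\<^sub>R favre \<kappa> h w \<rho> f r = filtered \<kappa> h w (\<lambda>r'. \<rho> r' *\<^sub>R f r') r\<close>,
  since the filtered density is positive wherever the test space lies in the fluid domain.
\<close>

definition favre ::
  "real \<Rightarrow> real \<Rightarrow> (real^'n \<Rightarrow> real) \<Rightarrow> (real^'n \<Rightarrow> real)
    \<Rightarrow> (real^'n \<Rightarrow> 'b::{banach, second_countable_topology}) \<Rightarrow> real^'n \<Rightarrow> 'b" where
  "favre \<kappa> h w \<rho> f r = filtered \<kappa> h w (\<lambda>r'. \<rho> r' *\<^sub>R f r') r /\<^sub>R filtered \<kappa> h w \<rho> r"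

end

(* Write A and M for the filtered density and the filtered momentum \<rho>u, so that the filtered velocity is
   U = M / A and A dU/dt = dM/dt - (dA/dt) U with d/dt the derivative in the space-time direction (U, 1).
   Differentiating under the integral sign, spatial derivatives of A and M fall on the kernel and time
   derivatives fall on the fields. By the conservative forms of the two balance laws and integration by
   parts, the time derivatives become fluxes against the gradient of the kernel; together with the
   terms already there they are the expansion of (U - u)((U - u) . grad w) under the integral.

   Integrands are extended by zero outside \<Omega>. Near r this keeps them C^1 on the whole space, because
   the kernel vanishes beyond its radius, so everything reduces to compactly supported integrands. *)

theory Submission
  imports Defs
begin

section \<open>Calculus of C^1 maps on open sets\<close>

lemma Ck_on_Suc0_has_derivative:
  assumes "Ck_on (Suc 0) S f" "x \<in> S"
  shows "(f has_derivative frechet_derivative f (at x)) (at x)"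
  using assms by (simp add: frechet_derivative_works)

lemma Ck_on_Suc0_continuous_on:
  assumes "Ck_on (Suc 0) S f"
  shows "continuous_on S f"
  using assms
  by (intro continuous_at_imp_continuous_on ballI differentiable_imp_continuous_within) auto

lemma Ck_on_Suc0_continuous_on_derivative:
  assumes "Ck_on (Suc 0) S f"
  shows "continuous_on S (\<lambda>x. frechet_derivative f (at x) v)"
  using assms by (simp only: Ck_on.simps)

text \<open>\<open>frechet_derivative\<close> is a choice operator. Uniqueness of the derivative
  identifies it with any explicit candidate \<open>D\<close>, and this is how C^1 regularity gets
  verified for concrete functions.\<close>

lemma Ck_on_Suc0I:
  assumes "\<And>x. x \<in> S \<Longrightarrow> (f has_derivative D x) (at x)"
    and "\<And>v. continuous_on S (\<lambda>x. D x v)"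
  shows "Ck_on (Suc 0) S f"
proof -
  have "frechet_derivative f (at x) = D x" if "x \<in> S" for x
    using frechet_derivative_at[OF assms(1)[OF that]] by simp
  then show ?thesis
    using assms by (auto simp: differentiable_def cong: continuous_on_cong)
qed

lemma Ck_on_Suc0_scaleR:
  fixes f :: "'a::euclidean_space \<Rightarrow> real"
  assumes f: "Ck_on (Suc 0) S f" and g: "Ck_on (Suc 0) S g"
  shows "Ck_on (Suc 0) S (\<lambda>x. f x *\<^sub>R g x)"
proof (rule Ck_on_Suc0I)
  show "((\<lambda>x. f x *\<^sub>R g x) has_derivative (\<lambda>v. f x *\<^sub>R frechet_derivative g (at x) v
      + frechet_derivative f (at x) v *\<^sub>R g x)) (at x)" if "x \<in> S" for x
    by (intro has_derivative_scaleR Ck_on_Suc0_has_derivative[OF f that] Ck_on_Suc0_has_derivative[OF g that])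
qed (intro continuous_intros Ck_on_Suc0_continuous_on Ck_on_Suc0_continuous_on_derivative f g)

text \<open>\<open>Ck_on\<close> controls a derivative only along each fixed direction. Expanding
  the direction in the finite basis extends this to directions that vary with the point, such as the
  momentum at \<open>y\<close>.\<close>

lemma continuous_on_linear_apply:
  fixes D :: "'z::topological_space \<Rightarrow> 'a::euclidean_space \<Rightarrow> 'b::real_normed_vector"
  assumes "\<And>z. z \<in> S \<Longrightarrow> linear (D z)"
    and "\<And>v. continuous_on S (\<lambda>z. D z v)"
    and "continuous_on S c"
  shows "continuous_on S (\<lambda>z. D z (c z))"
proof -
  have "D z (c z) = (\<Sum>i\<in>Basis. (c z \<bullet> i) *\<^sub>R D z i)" if "z \<in> S" for z
  proof -
    have "D z (c z) = D z (\<Sum>i\<in>Basis. (c z \<bullet> i) *\<^sub>R i)"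
      by (simp add: euclidean_representation)
    then show ?thesis
      by (simp only: linear_sum[OF assms(1)[OF that]] linear_cmul[OF assms(1)[OF that]])
  qed
  moreover have "continuous_on S (\<lambda>z. \<Sum>i\<in>Basis. (c z \<bullet> i) *\<^sub>R D z i)"
    by (intro continuous_intros assms)
  ultimately show ?thesis
    by (simp cong: continuous_on_cong)
qed

section \<open>Integrals of compactly supported functions\<close>

lemma lborel_integral_eq_integral_cbox:
  fixes g :: "'a::euclidean_space \<Rightarrow> 'b::euclidean_space"
  assumes "continuous_on UNIV g" and "\<And>y. y \<notin> cbox a b \<Longrightarrow> g y = 0"
  shows "(LINT y|lborel. g y) = integral (cbox a b) g"
proof -
  have eq: "(\<lambda>y. indicator (cbox a b) y *\<^sub>R g y) = g"
    using assms(2) by (auto simp: indicator_def)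
  have "integrable lborel (\<lambda>y. indicator (cbox a b) y *\<^sub>R g y)"
    by (intro borel_integrable_compact compact_cbox continuous_on_subset[OF assms(1)]) auto
  then show ?thesis
    using set_borel_integral_eq_integral(2)[of "cbox a b" g]
    by (simp_all add: set_integrable_def set_lebesgue_integral_def eq)
qed

text \<open>A bounded set \<open>K\<close> carrying the support for all parameters at once puts
  every integral on one fixed box, where the Leibniz rule for compact boxes applies.\<close>

lemma has_derivative_lborel_integral:
  fixes G :: "'p::euclidean_space \<Rightarrow> 'a::euclidean_space \<Rightarrow> 'b::euclidean_space"
  assumes U: "convex U" "open U" "z0 \<in> U" and K: "bounded K"
    and der: "\<And>z y. z \<in> U \<Longrightarrow> ((\<lambda>z. G z y) has_derivative G' z y) (at z)"
    and cont: "\<And>z. z \<in> U \<Longrightarrow> continuous_on UNIV (G z)"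
    and cont': "\<And>v. continuous_on (U \<times> UNIV) (\<lambda>(z, y). G' z y v)"
    and supp: "\<And>z y. z \<in> U \<Longrightarrow> y \<notin> K \<Longrightarrow> G z y = 0"
  shows "((\<lambda>z. LINT y|lborel. G z y) has_derivative (\<lambda>v. LINT y|lborel. G' z0 y v)) (at z0)"
proof -
  obtain a b where ab: "K \<subseteq> cbox a b"
    using bounded_subset_cbox_symmetric[OF K] by blast
  \<comment> \<open>\<open>leibniz_rule\<close> needs the derivative as a continuous function into
    the bounded linear maps. The parameter space is finite-dimensional, so continuity there reduces
    to basis directions.\<close>
  define D where "D z y = Blinfun (G' z y)" for z y
  have D: "blinfun_apply (D z y) = G' z y" if "z \<in> U" for z y
    unfolding D_def using has_derivative_bounded_linear[OF der[OF that]]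
    by (rule bounded_linear_Blinfun_apply)
  \<comment> \<open>For \<open>y\<close> off \<open>K\<close> the integrand is zero for every
    parameter in the open set \<open>U\<close>, so its parameter derivative is zero as well.\<close>
  have supp': "G' z y v = 0" if "z \<in> U" "y \<notin> K" for z y v
  proof -
    have "((\<lambda>_. 0) has_derivative G' z y) (at z)"
      by (rule has_derivative_transform_within_open[OF der[OF that(1)] U(2) that(1)])
        (simp add: supp that)
    from has_derivative_unique[OF this has_derivative_const] show ?thesis by simp
  qed
  have contD: "continuous_on (U \<times> UNIV) (\<lambda>(z, y). D z y)"
  proof (rule continuous_on_blinfun_componentwise)
    fix i :: 'p
    show "continuous_on (U \<times> UNIV) (\<lambda>x. blinfun_apply (case x of (z, y) \<Rightarrow> D z y) i)"
      by (rule continuous_on_eq[OF cont'[of i]]) (auto simp: D)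
  qed
  have "((\<lambda>z. integral (cbox a b) (G z)) has_derivative
      blinfun_apply (integral (cbox a b) (D z0))) (at z0 within U)"
  proof (rule leibniz_rule)
    show "((\<lambda>z. G z y) has_derivative blinfun_apply (D z y)) (at z within U)" if "z \<in> U" for z y
      using der[OF that] by (simp add: D that has_derivative_at_withinI)
    show "G z integrable_on cbox a b" if "z \<in> U" for z
      by (intro integrable_continuous continuous_on_subset[OF cont[OF that]]) auto
    show "continuous_on (U \<times> cbox a b) (\<lambda>(z, y). D z y)"
      by (rule continuous_on_subset[OF contD]) auto
  qed (use U in auto)
  then have 1: "((\<lambda>z. integral (cbox a b) (G z)) has_derivative
      blinfun_apply (integral (cbox a b) (D z0))) (at z0)"
    by (simp only: at_within_open[OF U(3,2)])
  have contD0: "continuous_on UNIV (D z0)"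
  proof -
    have "continuous_on UNIV (\<lambda>y. (z0, y))"
      by (intro continuous_intros)
    from continuous_on_compose2[OF contD this] U show ?thesis by auto
  qed
  have "blinfun_apply (integral (cbox a b) (D z0)) v = (LINT y|lborel. G' z0 y v)" for v
  proof -
    have "D z0 integrable_on cbox a b"
      by (intro integrable_continuous continuous_on_subset[OF contD0]) auto
    then have "blinfun_apply (integral (cbox a b) (D z0)) v = integral (cbox a b) (\<lambda>y. D z0 y v)"
      by (simp add: blinfun_apply_integral)
    also have "\<dots> = (LINT y|lborel. D z0 y v)"
    proof (rule lborel_integral_eq_integral_cbox[symmetric])
      show "continuous_on UNIV (\<lambda>y. blinfun_apply (D z0 y) v)"
        by (intro continuous_intros contD0)
      show "blinfun_apply (D z0 y) v = 0" if "y \<notin> cbox a b" for y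
        using supp' U ab that by (auto simp: D)
    qed
    finally show ?thesis using U by (simp add: D)
  qed
  then have 2: "blinfun_apply (integral (cbox a b) (D z0)) = (\<lambda>v. LINT y|lborel. G' z0 y v)"
    by (rule ext)
  show ?thesis
  proof (rule has_derivative_transform_within_open[OF 1[unfolded 2] U(2,3)])
    show "integral (cbox a b) (G z) = (LINT y|lborel. G z y)" if "z \<in> U" for z
      using supp ab that cont by (intro lborel_integral_eq_integral_cbox[symmetric]) auto
  qed
qed

text \<open>The map has Jacobian factor 1. The case \<open>c = 1\<close> is a translation;
  \<open>c = -1\<close> is the reflection that turns \<open>w (r - y)\<close> into
  \<open>w y\<close>.\<close>

lemma lborel_integral_affine:
  fixes f :: "'a::euclidean_space \<Rightarrow> 'b::{banach, second_countable_topology}"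
  assumes "f \<in> borel_measurable borel" "\<bar>c\<bar> = 1"
  shows "(LINT y|lborel. f (a + c *\<^sub>R y)) = (LINT y|lborel. f y)"
proof -
  have "lborel = distr lborel borel (\<lambda>y. a + c *\<^sub>R y)"
    using lborel_affine[of c a] assms(2) by (auto simp: density_1)
  then have "(LINT y|lborel. f y) = (LINT y|distr lborel borel (\<lambda>y. a + c *\<^sub>R y). f y)"
    by simp
  also have "\<dots> = (LINT y|lborel. f (a + c *\<^sub>R y))"
    using assms by (intro integral_distr) auto
  finally show ?thesis by simp
qed

lemma lborel_integral_frechet_derivative_eq_0:
  fixes f :: "'a::euclidean_space \<Rightarrow> 'b::euclidean_space"
  assumes f: "Ck_on (Suc 0) UNIV f" and supp: "\<And>y. norm y > R \<Longrightarrow> f y = 0"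
  shows "(LINT y|lborel. frechet_derivative f (at y) v) = 0"
proof -
  \<comment> \<open>differentiate the integral of the translates of \<open>f\<close> along \<open>v\<close>, which is constant\<close>
  have cf: "continuous_on UNIV f" and cf': "\<And>v. continuous_on UNIV (\<lambda>x. frechet_derivative f (at x) v)"
    using Ck_on_Suc0_continuous_on[OF f] f by auto
  have lin: "linear (frechet_derivative f (at y))" for y
    using has_derivative_linear[OF Ck_on_Suc0_has_derivative[OF f]] by auto
  have "((\<lambda>z. LINT y|lborel. f (z *\<^sub>R v + y)) has_derivative
      (\<lambda>\<sigma>. LINT y|lborel. frechet_derivative f (at (0 *\<^sub>R v + y)) (\<sigma> *\<^sub>R v))) (at (0::real))"
  \<comment> \<open>Parameters of modulus below 1 shift the support by at most
    \<open>norm v\<close>, hence the enlarged radius.\<close>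
  proof (rule has_derivative_lborel_integral[where U = "ball 0 1" and K = "cball 0 (R + norm v)"
        and G' = "\<lambda>z y \<sigma>. frechet_derivative f (at (z *\<^sub>R v + y)) (\<sigma> *\<^sub>R v)"])
    show "((\<lambda>z. f (z *\<^sub>R v + y)) has_derivative
        (\<lambda>\<sigma>. frechet_derivative f (at (z *\<^sub>R v + y)) (\<sigma> *\<^sub>R v))) (at z)" for z y
      by (rule has_derivative_compose[of "\<lambda>z. z *\<^sub>R v + y", OF _ Ck_on_Suc0_has_derivative[OF f]])
        (auto intro!: derivative_eq_intros)
    show "continuous_on UNIV (\<lambda>y. f (z *\<^sub>R v + y))" for z
      by (intro continuous_on_compose2[OF cf] continuous_intros) auto
    show "continuous_on (ball 0 1 \<times> UNIV) (\<lambda>(z, y). frechet_derivative f (at (z *\<^sub>R v + y)) (\<sigma> *\<^sub>R v))" for \<sigma>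
      unfolding case_prod_beta
      by (intro continuous_on_compose2[OF cf'] continuous_intros) auto
    fix z :: real and y :: 'a assume "z \<in> ball 0 1" and y: "y \<notin> cball 0 (R + norm v)"
    then have "norm (z *\<^sub>R v) \<le> 1 * norm v"
      unfolding norm_scaleR by (intro mult_right_mono) auto
    moreover have "norm y \<le> norm (z *\<^sub>R v + y) + norm (z *\<^sub>R v)"
      by (metis add.commute add_diff_cancel_left' norm_triangle_ineq4)
    ultimately show "f (z *\<^sub>R v + y) = 0"
      using y by (intro supp) auto
  qed auto
  moreover have "(\<lambda>z. LINT y|lborel. f (z *\<^sub>R v + y)) = (\<lambda>z. LINT y|lborel. f y)"
    using lborel_integral_affine[OF borel_measurable_continuous_onI[OF cf], of 1] by simp
  ultimately have "(\<lambda>\<sigma>. LINT y|lborel. frechet_derivative f (at (0 *\<^sub>R v + y)) (\<sigma> *\<^sub>R v)) = (\<lambda>\<sigma>. 0)"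
    using has_derivative_unique has_derivative_const by metis
  from fun_cong[OF this, of 1] show ?thesis by simp
qed

text \<open>Continuity is local, and both pieces are open: the extension is \<open>f\<close> on
  \<open>S\<close> and identically zero on \<open>T\<close>. In the applications \<open>S\<close>
  lies over the fluid domain and the kernel vanishes on \<open>T\<close>.\<close>

lemma continuous_on_zero_extension:
  fixes f :: "'a::topological_space \<Rightarrow> 'b::{topological_space, zero}"
  assumes "open S" "open T" "continuous_on S f" "\<And>p. p \<in> S \<Longrightarrow> p \<in> T \<Longrightarrow> f p = 0"
  shows "continuous_on (S \<union> T) (\<lambda>p. if p \<in> S then f p else 0)"
proof (intro continuous_on_open_Un assms)
  show "continuous_on S (\<lambda>p. if p \<in> S then f p else 0)"
    by (rule continuous_on_eq[OF assms(3)]) simp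
  show "continuous_on T (\<lambda>p. if p \<in> S then f p else 0)"
    by (rule continuous_on_eq[OF continuous_on_const[of _ 0]]) (simp add: assms(4))
qed

section \<open>Partial, time and material derivatives from one space-time derivative\<close>

lemma linear_eq_sum_axis:
  fixes f :: "real^'n \<Rightarrow> 'b::real_vector"
  assumes "linear f"
  shows "f x = (\<Sum>j\<in>UNIV. (x $ j) *\<^sub>R f (axis j 1))"
proof -
  have "f x = f (\<Sum>j\<in>UNIV. (x $ j) *\<^sub>R axis j 1)"
    using basis_expansion[of x] by (simp add: scalar_mult_eq_scaleR)
  then show ?thesis
    by (simp only: linear_sum[OF assms] linear_cmul[OF assms])
qed

text \<open>Composition with the embeddings of the space and time slices reads every derivative off
  the single linear map \<open>F\<close>. By linearity the material derivative is the directional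
  derivative along \<open>(v t x, 1)\<close>, so no coordinate sums are needed for it later.\<close>

lemma spacetime_has_derivativeD:
  fixes f :: "real \<Rightarrow> real^'n \<Rightarrow> 'b::real_normed_vector"
  assumes F: "((\<lambda>(x, t). f t x) has_derivative F) (at (x, t))"
  shows "(f t has_derivative (\<lambda>v. F (v, 0))) (at x)"
    and "((\<lambda>s. f s x) has_derivative (\<lambda>\<sigma>. F (0, \<sigma>))) (at t)"
    and "time_deriv f t x = F (0, 1)"
    and "material_deriv v f t x = F (v t x, 1)"
proof -
  show space: "(f t has_derivative (\<lambda>v. F (v, 0))) (at x)"
  proof -
    have "((\<lambda>x. (x, t)) has_derivative (\<lambda>v. (v, 0))) (at x)"
      by (auto intro!: derivative_eq_intros)
    from has_derivative_compose[OF this F] show ?thesis by simp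
  qed
  show time: "((\<lambda>s. f s x) has_derivative (\<lambda>\<sigma>. F (0, \<sigma>))) (at t)"
  proof -
    have "((\<lambda>s. (x, s)) has_derivative (\<lambda>\<sigma>. (0, \<sigma>))) (at t)"
      by (auto intro!: derivative_eq_intros)
    from has_derivative_compose[OF this F] show ?thesis by simp
  qed
  note lin = has_derivative_linear[OF F]
  have "((\<lambda>s. f s x) has_vector_derivative F (0, 1)) (at t)"
    unfolding has_vector_derivative_def
    by (rule has_derivative_eq_rhs[OF time]) (simp add: fun_eq_iff flip: linear_cmul[OF lin])
  then show td: "time_deriv f t x = F (0, 1)"
    by (simp add: time_deriv_def vector_derivative_at)
  have "advect (v t x) (f t) x = F (v t x, 0)"
    using linear_eq_sum_axis[OF has_derivative_linear[OF space], of "v t x"]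
      frechet_derivative_at[OF space, symmetric]
    by (simp add: advect_def partial_deriv_def)
  then show "material_deriv v f t x = F (v t x, 1)"
    using linear_add[OF lin, of "(0, 1)" "(v t x, 0)"] by (simp add: material_deriv_def td)
qed

lemma Ck_on_Suc0_slice:
  fixes f :: "real \<Rightarrow> real^'n \<Rightarrow> 'b::real_normed_vector"
  assumes f: "Ck_on (Suc 0) (\<Omega> \<times> I) (\<lambda>(x, t). f t x)" and "t \<in> I"
  shows "Ck_on (Suc 0) \<Omega> (f t)"
proof (rule Ck_on_Suc0I)
  show "(f t has_derivative (\<lambda>v. frechet_derivative (\<lambda>(x, t). f t x) (at (x, t)) (v, 0))) (at x)"
    if "x \<in> \<Omega>" for x
    using that \<open>t \<in> I\<close>
    by (intro spacetime_has_derivativeD(1) Ck_on_Suc0_has_derivative[OF f]) auto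
  have "continuous_on (\<Omega> \<times> I) (\<lambda>z. frechet_derivative (\<lambda>(x, t). f t x) (at z) (v, 0))" for v
    by (rule Ck_on_Suc0_continuous_on_derivative[OF f])
  then show "continuous_on \<Omega> (\<lambda>x. frechet_derivative (\<lambda>(x, t). f t x) (at (x, t)) (v, 0))" for v
    by (rule continuous_on_compose2[where f = "\<lambda>x. (x, t)"])
      (use \<open>t \<in> I\<close> in \<open>auto intro!: continuous_intros\<close>)
qed

section \<open>The test space and filtered integrals\<close>

lemma test_space_eq_cball: "test_space \<kappa> h r = cball r (\<kappa> * h)"
  by (auto simp: test_space_def dist_norm)

lemma set_integrable_test_space:
  fixes g :: "real^'n \<Rightarrow> 'b::{banach, second_countable_topology}"
  assumes "continuous_on (test_space \<kappa> h r) g"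
  shows "set_integrable lborel (test_space \<kappa> h r) g"
  unfolding set_integrable_def
  by (rule borel_integrable_compact[OF _ assms]) (simp add: test_space_eq_cball)

lemma set_integral_test_space_scaleR_left:
  fixes a :: "'b::{banach, second_countable_topology}"
  assumes "continuous_on (test_space \<kappa> h r) f"
  shows "(LINT y:test_space \<kappa> h r|lborel. f y *\<^sub>R a) = (LINT y:test_space \<kappa> h r|lborel. f y) *\<^sub>R a"
  using integral_scaleR_left[of a lborel "\<lambda>y. indicator (test_space \<kappa> h r) y *\<^sub>R f y"]
    set_integrable_test_space[OF assms]
  by (simp add: set_lebesgue_integral_def set_integrable_def)

lemma filtered_cong:
  assumes "\<And>y. y \<in> test_space \<kappa> h r \<Longrightarrow> f y = g y"
  shows "filtered \<kappa> h k f r = filtered \<kappa> h k g r"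
  unfolding filtered_def
  using assms by (intro set_lebesgue_integral_cong) (auto simp: test_space_eq_cball)

text \<open>The kernel \<open>k\<close> vanishes off the test space, so the moving ball can be
  traded for the whole space. Then \<open>x\<close> occurs only in the integrand, which makes
  differentiation in \<open>x\<close> possible, and values of \<open>f\<close> outside
  \<open>\<Omega>\<close> are discarded.\<close>

lemma filtered_eq_lborel_integral:
  fixes f :: "real^'n \<Rightarrow> 'b::{banach, second_countable_topology}"
  assumes "\<And>z. norm z > \<kappa> * h \<Longrightarrow> k z = 0" and "test_space \<kappa> h x \<subseteq> \<Omega>"
  shows "filtered \<kappa> h k f x = (LINT y|lborel. (if y \<in> \<Omega> then k (x - y) *\<^sub>R f y else 0))"
proof -
  have "k (x - y) = 0" if "y \<notin> test_space \<kappa> h x" for y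
    using that assms(1) by (simp add: test_space_def)
  then show ?thesis
    unfolding filtered_def set_lebesgue_integral_def
    using assms(2) by (intro Bochner_Integration.integral_cong) (auto simp: indicator_def)
qed

section \<open>Filtering with a compactly supported C^1 kernel\<close>

context
  fixes \<kappa> h :: real and w :: "real^'n \<Rightarrow> real"
  assumes w: "Ck_on (Suc 0) UNIV w"
    and supp: "\<And>z. norm z > \<kappa> * h \<Longrightarrow> w z = 0"
begin

lemma kernel_has_derivative: "(w has_derivative frechet_derivative w (at z)) (at z)"
  using Ck_on_Suc0_has_derivative[OF w] by simp

text \<open>The exterior of the closed ball is open, so the kernel is zero in a whole neighbourhood
  of \<open>z\<close>.\<close>

lemma kernel_derivative_eq_0:
  assumes "norm z > \<kappa> * h"
  shows "frechet_derivative w (at z) v = 0"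
proof -
  have "open {z :: real^'n. norm z > \<kappa> * h}"
    by (intro open_Collect_less continuous_intros)
  then have "((\<lambda>_. 0) has_derivative frechet_derivative w (at z)) (at z)"
    by (rule has_derivative_transform_within_open[OF kernel_has_derivative]) (use assms supp in auto)
  from has_derivative_unique[OF this has_derivative_const] show ?thesis by simp
qed

lemma continuous_on_kernel:
  assumes "continuous_on S c"
  shows "continuous_on S (\<lambda>y. w (c y))"
  by (rule continuous_on_compose2[OF Ck_on_Suc0_continuous_on[OF w] assms]) auto

lemma continuous_on_kernel_derivative:
  assumes "continuous_on S c" "continuous_on S m"
  shows "continuous_on S (\<lambda>y. frechet_derivative w (at (c y)) (m y))"
proof (rule continuous_on_linear_apply[where D = "\<lambda>y. frechet_derivative w (at (c y))"])
  show "continuous_on S (\<lambda>y. frechet_derivative w (at (c y)) v)" for v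
    by (rule continuous_on_compose2[OF Ck_on_Suc0_continuous_on_derivative[OF w] assms(1)]) auto
qed (use kernel_has_derivative has_derivative_linear assms in blast)+

lemmas kernel_intros = continuous_on_kernel continuous_on_kernel_derivative

text \<open>In the integrand \<open>w (x - y) *\<^sub>R f s y\<close> the point \<open>x\<close>
  enters only through the kernel and the time \<open>s\<close> only through the field, which gives
  the two terms.\<close>

lemma filtered_has_derivative:
  fixes f :: "real \<Rightarrow> real^'n \<Rightarrow> 'b::euclidean_space"
  assumes f: "Ck_on (Suc 0) (\<Omega> \<times> I) (\<lambda>(x, t). f t x)"
    and "open \<Omega>" "open I" and r: "test_space \<kappa> h r \<subseteq> \<Omega>" and "t \<in> I"
  shows "((\<lambda>(x, s). filtered \<kappa> h w (f s) x) has_derivative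
     (\<lambda>(v, \<sigma>). filtered \<kappa> h (\<lambda>z. frechet_derivative w (at z) v) (f t) r
        + \<sigma> *\<^sub>R filtered \<kappa> h w (time_deriv f t) r)) (at (r, t))"
proof -
  define F where "F = (\<lambda>z. frechet_derivative (\<lambda>(x, t). f t x) (at z))"
  have F: "((\<lambda>(x, t). f t x) has_derivative F (y, s)) (at (y, s))" if "y \<in> \<Omega>" "s \<in> I" for y s
    unfolding F_def using that by (intro Ck_on_Suc0_has_derivative[OF f]) auto
  \<comment> \<open>The test space is compact, so it has a uniform margin \<open>e\<close> inside
    \<open>\<Omega>\<close>. A point in the test space of a nearby \<open>x\<close> is carried by
    the shift \<open>r - x\<close>, shorter than \<open>e\<close>, into that of \<open>r\<close>;
    hence all these test spaces stay in \<open>\<Omega>\<close>.\<close>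
  obtain e where e: "e > 0" "(\<Union>x\<in>test_space \<kappa> h r. cball x e) \<subseteq> \<Omega>"
    using compact_subset_open_imp_cball_epsilon_subset[OF _ \<open>open \<Omega>\<close> r]
    by (metis compact_cball test_space_eq_cball)
  obtain d where d: "d > 0" "ball t d \<subseteq> I"
    using \<open>open I\<close> \<open>t \<in> I\<close> open_contains_ball by metis
  define U where "U = ball r e \<times> ball t d"
  have sub: "test_space \<kappa> h x \<subseteq> \<Omega>" if "x \<in> ball r e" for x
  proof
    fix y assume "y \<in> test_space \<kappa> h x"
    then have "y + (r - x) \<in> test_space \<kappa> h r" "y \<in> cball (y + (r - x)) e"
      using that by (auto simp: test_space_def dist_norm algebra_simps norm_minus_commute)
    then show "y \<in> \<Omega>" using e(2) by blast
  qed
  \<comment> \<open>On \<open>V\<close> the kernel and its derivative vanish. With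
    \<open>U \<times> \<Omega>\<close> it covers all pairs with parameter in \<open>U\<close>, so
    the zero extensions are continuous whatever the fields do outside
    \<open>\<Omega>\<close>.\<close>
  define V where "V = {(z, y). z \<in> U \<and> norm (fst z - y) > \<kappa> * h}"
  have "open V"
  proof -
    have "V = (U \<times> UNIV) \<inter> {p. norm (fst (fst p) - snd p) > \<kappa> * h}"
      by (auto simp: V_def)
    moreover have "open {p. norm (fst (fst p) - snd p) > \<kappa> * h}"
      by (intro open_Collect_less continuous_intros kernel_intros)
    ultimately show ?thesis by (auto simp: U_def intro!: open_Times)
  qed
  have cover: "U \<times> UNIV = (U \<times> \<Omega>) \<union> V"
    using sub by (fastforce simp: V_def U_def test_space_def)
  have "open (U \<times> \<Omega>)"
    using \<open>open \<Omega>\<close> by (auto simp: U_def intro!: open_Times)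
  note ext = continuous_on_zero_extension[OF \<open>open (U \<times> \<Omega>)\<close> \<open>open V\<close>, folded cover]
  define G where "G z y = (if y \<in> \<Omega> then w (fst z - y) *\<^sub>R f (snd z) y else 0)" for z y
  \<comment> \<open>The product rule in the parameter \<open>z\<close>. Since \<open>y\<close> is
    held fixed, the field is differentiated only in the time direction
    \<open>(0, snd v)\<close>.\<close>
  define G' where "G' z y v = (if y \<in> \<Omega> then frechet_derivative w (at (fst z - y)) (fst v) *\<^sub>R f (snd z) y
      + w (fst z - y) *\<^sub>R F (y, snd z) (0, snd v) else 0)" for z y v
  have swap: "continuous_on (U \<times> \<Omega>) (\<lambda>p. (snd p, snd (fst p)))"
    "(\<lambda>p. (snd p, snd (fst p))) ` (U \<times> \<Omega>) \<subseteq> \<Omega> \<times> I"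
    using d by (auto simp: U_def intro!: continuous_intros kernel_intros)
  have cf: "continuous_on (U \<times> \<Omega>) (\<lambda>p. f (snd (fst p)) (snd p))"
    using continuous_on_compose2[OF Ck_on_Suc0_continuous_on[OF f] swap] by simp
  have cF: "continuous_on (U \<times> \<Omega>) (\<lambda>p. F (snd p, snd (fst p)) v)" for v
  proof -
    have "continuous_on (\<Omega> \<times> I) (\<lambda>z. F z v)"
      unfolding F_def by (rule Ck_on_Suc0_continuous_on_derivative[OF f])
    from continuous_on_compose2[OF this swap] show ?thesis by simp
  qed
  have cG: "continuous_on (U \<times> UNIV) (\<lambda>(z, y). G z y)"
    by (rule continuous_on_eq[OF ext, of "\<lambda>p. w (fst (fst p) - snd p) *\<^sub>R f (snd (fst p)) (snd p)"])
      (auto simp: G_def V_def supp split: if_splits intro!: continuous_intros kernel_intros cf)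
  have cG': "continuous_on (U \<times> UNIV) (\<lambda>(z, y). G' z y v)" for v
    by (rule continuous_on_eq[OF ext, of "\<lambda>p. frechet_derivative w (at (fst (fst p) - snd p)) (fst v) *\<^sub>R
          f (snd (fst p)) (snd p) + w (fst (fst p) - snd p) *\<^sub>R F (snd p, snd (fst p)) (0, snd v)"])
      (auto simp: G'_def V_def supp kernel_derivative_eq_0 split: if_splits intro!: continuous_intros kernel_intros cf cF)
  have "((\<lambda>z. LINT y|lborel. G z y) has_derivative (\<lambda>v. LINT y|lborel. G' (r, t) y v)) (at (r, t))"
  proof (rule has_derivative_lborel_integral)
    show "convex U" "open U" "(r, t) \<in> U"
      using e d by (auto simp: U_def intro!: convex_Times open_Times)
    \<comment> \<open>The kernel radius, enlarged by the distance \<open>e\<close> that the centre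
      may move.\<close>
    show "bounded (cball r (e + \<kappa> * h))" by simp
    show "continuous_on (U \<times> UNIV) (\<lambda>(z, y). G' z y v)" for v
      by (rule cG')
    show "continuous_on UNIV (G z)" if "z \<in> U" for z
    proof -
      have "continuous_on UNIV (\<lambda>y. (z, y))"
        by (intro continuous_intros kernel_intros)
      from continuous_on_compose2[OF cG this] that show ?thesis by auto
    qed
    show "G z y = 0" if "z \<in> U" "y \<notin> cball r (e + \<kappa> * h)" for z y
    proof -
      have "dist r y \<le> dist r (fst z) + dist (fst z) y"
        by (rule dist_triangle)
      then have "norm (fst z - y) > \<kappa> * h"
        using that by (auto simp: U_def dist_norm)
      then show ?thesis by (simp add: G_def supp)
    qed
    show "((\<lambda>z. G z y) has_derivative G' z y) (at z)" if "z \<in> U" for z y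
    proof (cases "y \<in> \<Omega>")
      case True
      have "snd z \<in> I" using that d by (auto simp: U_def)
      have 1: "((\<lambda>z. w (fst z - y)) has_derivative
          (\<lambda>v. frechet_derivative w (at (fst z - y)) (fst v))) (at z)"
        by (rule has_derivative_compose[OF _ kernel_has_derivative]) (auto intro!: derivative_eq_intros)
      have 2: "((\<lambda>z. f (snd z) y) has_derivative (\<lambda>v. F (y, snd z) (0, snd v))) (at z)"
        using has_derivative_compose[OF has_derivative_snd[OF has_derivative_ident]
            spacetime_has_derivativeD(2)[OF F[OF True \<open>snd z \<in> I\<close>]]]
        by simp
      show ?thesis
        using True by (auto simp: G_def[abs_def] G'_def[abs_def] intro!: derivative_eq_intros 1 2)
    qed (simp add: G_def[abs_def] G'_def[abs_def])
  qed
  moreover have "(LINT y|lborel. G z y) = (case z of (x, s) \<Rightarrow> filtered \<kappa> h w (f s) x)" if "z \<in> U" for z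
    using that by (auto simp: G_def U_def filtered_eq_lborel_integral[where k = w, OF supp sub] cong: if_cong)
  moreover have "open U" "(r, t) \<in> U"
    using e d by (auto simp: U_def intro!: open_Times)
  ultimately have *: "((\<lambda>(x, s). filtered \<kappa> h w (f s) x) has_derivative
      (\<lambda>v. LINT y|lborel. G' (r, t) y v)) (at (r, t))"
    using has_derivative_transform_within_open by blast
  have cf_r: "continuous_on (test_space \<kappa> h r) (f t)"
    using Ck_on_Suc0_continuous_on[OF Ck_on_Suc0_slice[OF f \<open>t \<in> I\<close>]] r continuous_on_subset by blast
  have cF_r: "continuous_on (test_space \<kappa> h r) (\<lambda>y. F (y, t) v)" for v
    unfolding F_def
    by (rule continuous_on_compose2[OF Ck_on_Suc0_continuous_on_derivative[OF f]])
      (use r \<open>t \<in> I\<close> in \<open>auto intro!: continuous_intros kernel_intros\<close>)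
  have "(LINT y|lborel. G' (r, t) y v) = filtered \<kappa> h (\<lambda>z. frechet_derivative w (at z) (fst v)) (f t) r
        + snd v *\<^sub>R filtered \<kappa> h w (time_deriv f t) r" for v
  proof -
    have "(LINT y|lborel. G' (r, t) y v) = (LINT y:test_space \<kappa> h r|lborel.
        frechet_derivative w (at (r - y)) (fst v) *\<^sub>R f t y + w (r - y) *\<^sub>R F (y, t) (0, snd v))"
    proof -
      have "w (r - y) = 0 \<and> frechet_derivative w (at (r - y)) (fst v) = 0" if "y \<notin> test_space \<kappa> h r" for y
        using that by (simp add: test_space_def supp kernel_derivative_eq_0)
      then show ?thesis
        unfolding set_lebesgue_integral_def using r
        by (intro Bochner_Integration.integral_cong) (auto simp: G'_def indicator_def)
    qed
    also have "\<dots> = filtered \<kappa> h (\<lambda>z. frechet_derivative w (at z) (fst v)) (f t) r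
        + (LINT y:test_space \<kappa> h r|lborel. w (r - y) *\<^sub>R F (y, t) (0, snd v))"
      unfolding filtered_def
      by (intro set_integral_add set_integrable_test_space continuous_intros kernel_intros cf_r cF_r)
    also have "(LINT y:test_space \<kappa> h r|lborel. w (r - y) *\<^sub>R F (y, t) (0, snd v))
        = (LINT y:test_space \<kappa> h r|lborel. snd v *\<^sub>R (w (r - y) *\<^sub>R time_deriv f t y))"
    proof (intro set_lebesgue_integral_cong ballI allI impI)
      fix y assume "y \<in> test_space \<kappa> h r"
      then have "y \<in> \<Omega>" using r by auto
      note F = F[OF \<open>y \<in> \<Omega>\<close> \<open>t \<in> I\<close>]
      from linear_cmul[OF has_derivative_linear[OF F], of "snd v" "(0, 1)"]
      show "w (r - y) *\<^sub>R F (y, t) (0, snd v) = snd v *\<^sub>R (w (r - y) *\<^sub>R time_deriv f t y)"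
        using spacetime_has_derivativeD(3)[OF F] by (simp add: mult.commute)
    qed (simp add: test_space_eq_cball)
    finally show ?thesis
      by (simp only: filtered_def set_integral_scaleR_right)
  qed
  with * show ?thesis
    by (simp add: case_prod_beta')
qed

text \<open>Integration by parts: the \<open>y\<close>-derivative of
  \<open>w (r - y) *\<^sub>R g y\<close>, extended by zero, has integral zero. The inner derivative
  of \<open>r - y\<close> contributes a minus sign, which cancels the usual sign of integration by
  parts.\<close>

lemma filtered_frechet_derivative_kernel:
  fixes g :: "real^'n \<Rightarrow> 'b::euclidean_space"
  assumes g: "Ck_on (Suc 0) \<Omega> g" and "open \<Omega>" and r: "test_space \<kappa> h r \<subseteq> \<Omega>"
  shows "filtered \<kappa> h (\<lambda>z. frechet_derivative w (at z) v) g r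
    = filtered \<kappa> h w (\<lambda>y. frechet_derivative g (at y) v) r"
proof -
  define V where "V = {y. norm (r - y) > \<kappa> * h}"
  define P where "P y = w (r - y) *\<^sub>R g y" for y
  define P' where "P' y u = w (r - y) *\<^sub>R frechet_derivative g (at y) u
      - frechet_derivative w (at (r - y)) u *\<^sub>R g y" for y u
  define f where "f y = (if y \<in> \<Omega> then P y else 0)" for y
  define f' where "f' y u = (if y \<in> \<Omega> then P' y u else 0)" for y u
  have "open V"
    unfolding V_def by (intro open_Collect_less continuous_intros kernel_intros)
  have cover: "UNIV = \<Omega> \<union> V"
    using r by (fastforce simp: V_def test_space_def)
  have zero: "P y = 0" "P' y u = 0" if "y \<in> V" for y u
    using that by (auto simp: V_def P_def P'_def supp kernel_derivative_eq_0)
  have zero': "f y = 0" "f' y u = 0" if "y \<in> V" for y u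
    using zero that by (auto simp: f_def f'_def)
  have cP': "continuous_on \<Omega> (\<lambda>y. P' y u)" for u
    unfolding P'_def
    by (intro continuous_intros kernel_intros Ck_on_Suc0_continuous_on[OF g] Ck_on_Suc0_continuous_on_derivative[OF g])
  \<comment> \<open>Inside \<open>\<Omega>\<close> this is the product rule. Any other
    \<open>y\<close> lies in the open set \<open>V\<close>, on which \<open>f\<close> is identically
    zero, so nothing happens at the boundary of \<open>\<Omega>\<close>.\<close>
  have f': "(f has_derivative f' y) (at y)" for y
  proof (cases "y \<in> \<Omega>")
    case True
    have "((\<lambda>y. w (r - y)) has_derivative (\<lambda>v. frechet_derivative w (at (r - y)) (- v))) (at y)"
      by (rule has_derivative_compose[OF _ kernel_has_derivative]) (auto intro!: derivative_eq_intros)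
    then have "((\<lambda>y. w (r - y)) has_derivative (\<lambda>v. - frechet_derivative w (at (r - y)) v)) (at y)"
      by (simp add: linear_neg[OF has_derivative_linear[OF kernel_has_derivative]])
    from has_derivative_scaleR[OF this Ck_on_Suc0_has_derivative[OF g True]]
    have "(P has_derivative P' y) (at y)"
      by (simp add: P_def[abs_def] P'_def[abs_def])
    from has_derivative_transform_within_open[OF this \<open>open \<Omega>\<close> True, of f]
    show ?thesis
      using True by (simp add: f_def f'_def[abs_def])
  next
    case False
    then have "y \<in> V" using cover by auto
    have "f' y = (\<lambda>_. 0)"
      using zero'(2)[OF \<open>y \<in> V\<close>] by blast
    then have "((\<lambda>_. 0) has_derivative f' y) (at y)"
      by (simp add: has_derivative_const)
    then show ?thesis
      by (rule has_derivative_transform_within_open[OF _ \<open>open V\<close> \<open>y \<in> V\<close>]) (simp add: zero')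
  qed
  have "Ck_on (Suc 0) UNIV f"
  proof (rule Ck_on_Suc0I)
    show "continuous_on UNIV (\<lambda>y. f' y u)" for u
      using continuous_on_zero_extension[OF \<open>open \<Omega>\<close> \<open>open V\<close> cP'[of u]] zero
      by (simp add: f'_def flip: cover)
  qed (rule f')
  moreover have "f y = 0" if "norm y > norm r + \<kappa> * h" for y
  proof -
    have "norm y \<le> norm r + norm (r - y)"
      by (metis norm_minus_commute norm_triangle_sub)
    then show ?thesis using that by (intro zero') (simp add: V_def)
  qed
  ultimately have "0 = (LINT y|lborel. frechet_derivative f (at y) v)"
    using lborel_integral_frechet_derivative_eq_0[of f "norm r + \<kappa> * h" v] by simp
  also have "\<dots> = (LINT y|lborel. f' y v)"
    using frechet_derivative_at[OF f'] by simp
  also have "\<dots> = (LINT y:test_space \<kappa> h r|lborel. w (r - y) *\<^sub>R frechet_derivative g (at y) v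
      - frechet_derivative w (at (r - y)) v *\<^sub>R g y)"
  proof -
    have "y \<in> V" if "y \<notin> test_space \<kappa> h r" for y
      using that by (simp add: V_def test_space_def)
    then show ?thesis
      unfolding set_lebesgue_integral_def using r zero(2)
      by (intro Bochner_Integration.integral_cong) (auto simp: f'_def indicator_def simp flip: P'_def)
  qed
  also have "\<dots> = filtered \<kappa> h w (\<lambda>y. frechet_derivative g (at y) v) r
      - filtered \<kappa> h (\<lambda>z. frechet_derivative w (at z) v) g r"
    unfolding filtered_def
    by (intro set_integral_diff set_integrable_test_space continuous_intros kernel_intros
        continuous_on_subset[OF Ck_on_Suc0_continuous_on[OF g] r]
        continuous_on_subset[OF Ck_on_Suc0_continuous_on_derivative[OF g] r])
  finally show ?thesis by simp
qed

text \<open>The gradient is taken in the first argument of the difference, so the chain rule brings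
  in no sign. This replaces gradients by coordinate-free directional derivatives.\<close>

lemma inner_grad_kernel: "a \<bullet> grad (\<lambda>x. w (x - y)) r = frechet_derivative w (at (r - y)) a"
proof -
  have "((\<lambda>x. w (x - y)) has_derivative frechet_derivative w (at (r - y))) (at r)"
    by (rule has_derivative_compose[OF _ kernel_has_derivative, of _ "\<lambda>v. v"])
      (auto intro!: derivative_eq_intros)
  from frechet_derivative_at[OF this]
  show ?thesis
    by (subst linear_eq_sum_axis[OF has_derivative_linear[OF kernel_has_derivative]])
      (simp add: inner_vec_def grad_def partial_deriv_def)
qed

lemma filtered_diff:
  fixes f :: "real^'n \<Rightarrow> 'b::{banach, second_countable_topology}"
  assumes "continuous_on (test_space \<kappa> h r) f" "continuous_on (test_space \<kappa> h r) g"
  shows "filtered \<kappa> h w (\<lambda>y. f y - g y) r = filtered \<kappa> h w f r - filtered \<kappa> h w g r"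
  unfolding filtered_def scaleR_diff_right
  by (intro set_integral_diff set_integrable_test_space continuous_intros kernel_intros assms)

text \<open>Integration by parts in each coordinate, followed by the product rule for the divergence
  of the flux of \<open>g\<close> along \<open>m\<close>. With \<open>m\<close> the momentum,
  \<open>g = 1\<close> yields the mass flux and \<open>g = u\<close> the momentum flux.\<close>

lemma set_integral_kernel_derivative_flux:
  fixes m :: "real^'n \<Rightarrow> real^'n" and g :: "real^'n \<Rightarrow> 'b::euclidean_space"
  assumes m: "Ck_on (Suc 0) \<Omega> m" and g: "Ck_on (Suc 0) \<Omega> g"
    and "open \<Omega>" and r: "test_space \<kappa> h r \<subseteq> \<Omega>"
  shows "(LINT y:test_space \<kappa> h r|lborel. frechet_derivative w (at (r - y)) (m y) *\<^sub>R g y)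
    = filtered \<kappa> h w (\<lambda>y. divergence m y *\<^sub>R g y + frechet_derivative g (at y) (m y)) r"
proof -
  define M where "M y = frechet_derivative m (at y)" for y
  define D where "D y = frechet_derivative g (at y)" for y
  have m': "((\<lambda>y. m y $ j) has_derivative (\<lambda>v. M y v $ j)) (at y)" if "y \<in> \<Omega>" for y j
    using bounded_linear.has_derivative[OF bounded_linear_vec_nth Ck_on_Suc0_has_derivative[OF m that]]
    by (simp add: M_def)
  have g': "(g has_derivative D y) (at y)" if "y \<in> \<Omega>" for y
    unfolding D_def by (rule Ck_on_Suc0_has_derivative[OF g that])
  have mg: "((\<lambda>y. m y $ j *\<^sub>R g y) has_derivative (\<lambda>v. m y $ j *\<^sub>R D y v + M y v $ j *\<^sub>R g y)) (at y)"
    if "y \<in> \<Omega>" for y j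
    by (rule has_derivative_scaleR[OF m'[OF that] g'[OF that]])
  have mg1: "Ck_on (Suc 0) \<Omega> (\<lambda>y. m y $ j *\<^sub>R g y)" for j
    by (rule Ck_on_Suc0I[OF mg], assumption, unfold M_def D_def)
      (intro continuous_intros kernel_intros Ck_on_Suc0_continuous_on m g Ck_on_Suc0_continuous_on_derivative)
  note cont = continuous_on_subset[OF Ck_on_Suc0_continuous_on r]
    continuous_on_subset[OF Ck_on_Suc0_continuous_on_derivative r]
  have set_integral_sum: "(LINT y:test_space \<kappa> h r|lborel. \<Sum>j\<in>UNIV. F j y)
      = (\<Sum>j\<in>UNIV. LINT y:test_space \<kappa> h r|lborel. F j y)"
    if "\<And>j. continuous_on (test_space \<kappa> h r) (F j)" for F :: "'n \<Rightarrow> real^'n \<Rightarrow> 'b"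
    using set_integrable_test_space[OF that]
    unfolding set_lebesgue_integral_def set_integrable_def scaleR_sum_right
    by (rule Bochner_Integration.integral_sum)
  \<comment> \<open>Integration by parts is available for a constant direction only, so the variable
    direction \<open>m y\<close> is expanded along the axes and its components are moved into the
    field.\<close>
  have "(LINT y:test_space \<kappa> h r|lborel. frechet_derivative w (at (r - y)) (m y) *\<^sub>R g y)
    = (LINT y:test_space \<kappa> h r|lborel. \<Sum>j\<in>UNIV. frechet_derivative w (at (r - y)) (axis j 1) *\<^sub>R m y $ j *\<^sub>R g y)"
  proof -
    have "frechet_derivative w (at (r - y)) (m y) *\<^sub>R g y
        = (\<Sum>j\<in>UNIV. frechet_derivative w (at (r - y)) (axis j 1) *\<^sub>R m y $ j *\<^sub>R g y)" for y
      by (subst linear_eq_sum_axis[OF has_derivative_linear[OF kernel_has_derivative]])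
        (simp add: scaleR_sum_left mult.commute)
    then show ?thesis by simp
  qed
  also have "\<dots> = (\<Sum>j\<in>UNIV. filtered \<kappa> h (\<lambda>z. frechet_derivative w (at z) (axis j 1)) (\<lambda>y. m y $ j *\<^sub>R g y) r)"
    unfolding filtered_def by (intro set_integral_sum continuous_intros kernel_intros cont m g)
  also have "\<dots> = (\<Sum>j\<in>UNIV. filtered \<kappa> h w (\<lambda>y. frechet_derivative (\<lambda>y. m y $ j *\<^sub>R g y) (at y) (axis j 1)) r)"
    using filtered_frechet_derivative_kernel[OF mg1 \<open>open \<Omega>\<close> r] by simp
  also have "\<dots> = (LINT y:test_space \<kappa> h r|lborel.
      \<Sum>j\<in>UNIV. w (r - y) *\<^sub>R frechet_derivative (\<lambda>y. m y $ j *\<^sub>R g y) (at y) (axis j 1))"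
    unfolding filtered_def by (intro set_integral_sum[symmetric] continuous_intros kernel_intros cont mg1)
  also have "\<dots> = filtered \<kappa> h w (\<lambda>y. divergence m y *\<^sub>R g y + frechet_derivative g (at y) (m y)) r"
    unfolding filtered_def
  proof (intro set_lebesgue_integral_cong allI impI)
    fix y assume "y \<in> test_space \<kappa> h r"
    then have y: "y \<in> \<Omega>" using r by auto
    have "(\<Sum>j\<in>UNIV. frechet_derivative (\<lambda>y. m y $ j *\<^sub>R g y) (at y) (axis j 1))
        = (\<Sum>j\<in>UNIV. m y $ j *\<^sub>R D y (axis j 1)) + (\<Sum>j\<in>UNIV. M y (axis j 1) $ j) *\<^sub>R g y"
      by (simp add: frechet_derivative_at[OF mg[OF y], symmetric] sum.distrib scaleR_sum_left)
    moreover have "divergence m y = (\<Sum>j\<in>UNIV. M y (axis j 1) $ j)"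
      by (simp add: divergence_def partial_deriv_def frechet_derivative_at[OF m'[OF y], symmetric])
    ultimately show "(\<Sum>j\<in>UNIV. w (r - y) *\<^sub>R frechet_derivative (\<lambda>y. m y $ j *\<^sub>R g y) (at y) (axis j 1))
        = w (r - y) *\<^sub>R (divergence m y *\<^sub>R g y + frechet_derivative g (at y) (m y))"
      using linear_eq_sum_axis[OF has_derivative_linear[OF g'[OF y]], of "m y"]
      by (simp add: D_def flip: scaleR_sum_right)
  qed (simp add: test_space_eq_cball)
  finally show ?thesis .
qed

text \<open>The kernel may vanish at many points, so the bound comes from the minimum of
  \<open>f\<close>, attained and positive on the compact test space: a kernel of mass 1 reproduces
  constants, and filtering is monotone because the kernel is nonnegative.\<close>

lemma filtered_pos:
  assumes w0: "\<And>z. w z \<ge> 0" and w1: "(LINT z|lborel. w z) = 1"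
    and "\<kappa> * h > 0" and f: "continuous_on (test_space \<kappa> h r) f"
    and pos: "\<And>y. y \<in> test_space \<kappa> h r \<Longrightarrow> f y > 0"
  shows "filtered \<kappa> h w f r > (0::real)"
proof -
  obtain y0 where y0: "y0 \<in> test_space \<kappa> h r" "\<And>y. y \<in> test_space \<kappa> h r \<Longrightarrow> f y0 \<le> f y"
    using continuous_attains_inf[OF _ _ f] \<open>\<kappa> * h > 0\<close> by (auto simp: test_space_eq_cball)
  have "filtered \<kappa> h w (\<lambda>_. f y0) r = f y0 * (LINT y|lborel. w (r - y))"
    using filtered_eq_lborel_integral[of \<kappa> h w r UNIV "\<lambda>_. f y0"] supp by (simp add: mult.commute)
  also have "(LINT y|lborel. w (r - y)) = (LINT y|lborel. w y)"
    using lborel_integral_affine[of w "-1" r] Ck_on_Suc0_continuous_on[OF w]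
    by (simp add: borel_measurable_continuous_onI)
  finally have "filtered \<kappa> h w (\<lambda>_. f y0) r = f y0" by (simp add: w1)
  moreover have "filtered \<kappa> h w (\<lambda>_. f y0) r \<le> filtered \<kappa> h w f r"
    unfolding filtered_def
    by (intro set_integral_mono set_integrable_test_space continuous_intros kernel_intros f)
      (simp add: y0 w0 mult_left_mono)
  ultimately show ?thesis using pos[OF y0(1)] by simp
qed

end

section \<open>The filtered momentum equation\<close>

theorem mainTheorem3:
  fixes \<Omega> :: "(real^'n) set" and I :: "real set" and \<kappa> h :: real
    and w :: "real^'n \<Rightarrow> real"
    and \<nu> \<rho> p :: "real \<Rightarrow> real^'n \<Rightarrow> real"
    and u b :: "real \<Rightarrow> real^'n \<Rightarrow> real^'n"
    and \<tau> :: "real \<Rightarrow> real^'n \<Rightarrow> real^'n^'n"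
    and \<rho>h :: "real \<Rightarrow> real^'n \<Rightarrow> real"
    and uh bh :: "real \<Rightarrow> real^'n \<Rightarrow> real^'n"
  assumes "\<tau> = (\<lambda>t. newtonian_stress (\<nu> t) (p t) (\<rho> t) (u t))"
    and "\<rho>h = (\<lambda>t. filtered \<kappa> h w (\<rho> t))"
    and "uh = (\<lambda>t. favre \<kappa> h w (\<rho> t) (u t))"
    and "bh = (\<lambda>t. favre \<kappa> h w (\<rho> t) (b t))"
    and "open \<Omega>" and "open I" and "is_interval I" and "h > 0" and "\<kappa> > 0"
    and "smooth_on UNIV w"
    and "\<And>x. w x \<ge> 0"
    and "(LINT x|lborel. w x) = 1"
    and "closure {x. w x \<noteq> 0} \<subseteq> cball 0 (\<kappa> * h)"
    and "smooth_on (\<Omega> \<times> I) (\<lambda>(x, t). \<rho> t x)"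
    and "smooth_on (\<Omega> \<times> I) (\<lambda>(x, t). p t x)"
    and "smooth_on (\<Omega> \<times> I) (\<lambda>(x, t). u t x)"
    and "smooth_on (\<Omega> \<times> I) (\<lambda>(x, t). b t x)"
    and "smooth_on (\<Omega> \<times> I) (\<lambda>(x, t). \<tau> t x)"
    and "\<And>x t. x \<in> \<Omega> \<Longrightarrow> t \<in> I \<Longrightarrow> \<rho> t x > 0"
    and "\<And>x t. x \<in> \<Omega> \<Longrightarrow> t \<in> I \<Longrightarrow>
          time_deriv \<rho> t x + u t x \<bullet> grad (\<rho> t) x = - \<rho> t x * divergence (u t) x"
    and "\<And>x t. x \<in> \<Omega> \<Longrightarrow> t \<in> I \<Longrightarrow>
          \<rho> t x *\<^sub>R material_deriv u u t x
            = tensor_divergence (\<tau> t) x + \<rho> t x *\<^sub>R b t x"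
    and "r \<in> resolved_domain \<kappa> h \<Omega>" and "t \<in> I"
  shows "(\<lambda>(x, s). uh s x) differentiable (at (r, t)) \<and>
    \<rho>h t r *\<^sub>R material_deriv uh uh t r
      = - (LINT r':test_space \<kappa> h r|lborel.
             \<rho> t r' *\<^sub>R (outer (uh t r - u t r') (uh t r - u t r') *v grad (\<lambda>x. w (x - r')) r))
        + filtered \<kappa> h w (tensor_divergence (\<tau> t)) r
        + \<rho>h t r *\<^sub>R bh t r"
proof -
  note \<rho>h = assms(2) and uh = assms(3) and bh = assms(4)
    and continuity = assms(20) and momentum = assms(21)
  let ?K = "test_space \<kappa> h r"
  have K: "?K \<subseteq> \<Omega>"
    using assms(22) by (simp add: resolved_domain_def)
  have w: "Ck_on (Suc 0) UNIV w"
    using assms(10) unfolding smooth_on_def by blast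
  have supp: "w z = 0" if "norm z > \<kappa> * h" for z
  proof (rule ccontr)
    assume "w z \<noteq> 0"
    then have "z \<in> cball 0 (\<kappa> * h)"
      using assms(13) closure_subset[of "{x. w x \<noteq> 0}"] by auto
    then show False using that by simp
  qed
  define m where "m = (\<lambda>t x. \<rho> t x *\<^sub>R u t x)"
  \<comment> \<open>All space and time derivatives of density and velocity at time \<open>t\<close>
    are values of the linear maps \<open>R' y\<close> and \<open>U' y\<close>.\<close>
  define R' where "R' y = frechet_derivative (\<lambda>(x, t). \<rho> t x) (at (y, t))" for y
  define U' where "U' y = frechet_derivative (\<lambda>(x, t). u t x) (at (y, t))" for y
  have \<rho>1: "Ck_on (Suc 0) (\<Omega> \<times> I) (\<lambda>(x, t). \<rho> t x)"
    and u1: "Ck_on (Suc 0) (\<Omega> \<times> I) (\<lambda>(x, t). u t x)"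
    and b1: "Ck_on (Suc 0) (\<Omega> \<times> I) (\<lambda>(x, t). b t x)"
    using assms(14,16,17) unfolding smooth_on_def by blast+
  have m1: "Ck_on (Suc 0) (\<Omega> \<times> I) (\<lambda>(x, t). m t x)"
    using Ck_on_Suc0_scaleR[OF \<rho>1 u1] by (simp add: m_def case_prod_beta')
  have \<rho>': "((\<lambda>(x, t). \<rho> t x) has_derivative R' y) (at (y, t))"
    and u': "((\<lambda>(x, t). u t x) has_derivative U' y) (at (y, t))" if "y \<in> \<Omega>" for y
    unfolding R'_def U'_def using that \<open>t \<in> I\<close>
    by (auto intro!: Ck_on_Suc0_has_derivative[OF \<rho>1] Ck_on_Suc0_has_derivative[OF u1])
  have m': "((\<lambda>(x, t). m t x) has_derivative (\<lambda>v. \<rho> t y *\<^sub>R U' y v + R' y v *\<^sub>R u t y)) (at (y, t))"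
    if "y \<in> \<Omega>" for y
    using has_derivative_scaleR[OF \<rho>'[OF that] u'[OF that]] by (simp add: m_def case_prod_beta')
  note slices = Ck_on_Suc0_slice[OF \<rho>1 \<open>t \<in> I\<close>] Ck_on_Suc0_slice[OF u1 \<open>t \<in> I\<close>]
    Ck_on_Suc0_slice[OF b1 \<open>t \<in> I\<close>] Ck_on_Suc0_slice[OF m1 \<open>t \<in> I\<close>]
  note cont = slices[THEN Ck_on_Suc0_continuous_on, THEN continuous_on_subset[OF _ K]]
  have pair: "continuous_on ?K (\<lambda>y. (y, t))" "(\<lambda>y. (y, t)) ` ?K \<subseteq> \<Omega> \<times> I"
    using K \<open>t \<in> I\<close> by (auto intro!: continuous_intros)
  have cont_R': "continuous_on ?K (\<lambda>y. R' y v)" and cont_U': "continuous_on ?K (\<lambda>y. U' y v')" for v v'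
    unfolding R'_def U'_def
    by (rule continuous_on_compose2[OF Ck_on_Suc0_continuous_on_derivative[OF \<rho>1] pair],
        rule continuous_on_compose2[OF Ck_on_Suc0_continuous_on_derivative[OF u1] pair])
  \<comment> \<open>By the momentum equation \<open>q\<close> is the total force density, stress
    divergence plus body force. In this form its continuity on the test space follows from the
    regularity of \<open>\<rho>\<close> and \<open>u\<close>.\<close>
  define q where "q y = \<rho> t y *\<^sub>R material_deriv u u t y" for y
  have time_deriv_\<rho>: "time_deriv \<rho> t y = R' y (0, 1)"
    and time_deriv_m: "time_deriv m t y = \<rho> t y *\<^sub>R U' y (0, 1) + R' y (0, 1) *\<^sub>R u t y"
    and q_eq: "q y = \<rho> t y *\<^sub>R U' y (u t y, 1)" if "y \<in> \<Omega>" for y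
    using spacetime_has_derivativeD(3)[OF \<rho>'[OF that]] spacetime_has_derivativeD(3)[OF m'[OF that]]
      spacetime_has_derivativeD(4)[OF u'[OF that]]
    by (simp_all add: q_def)
  have cont_time_deriv_\<rho>: "continuous_on ?K (time_deriv \<rho> t)"
    by (rule continuous_on_eq[OF cont_R'[of "(0, 1)"]]) (use K time_deriv_\<rho> in auto)
  have cont_time_deriv_m: "continuous_on ?K (time_deriv m t)"
    by (rule continuous_on_eq[of _ "\<lambda>y. \<rho> t y *\<^sub>R U' y (0, 1) + R' y (0, 1) *\<^sub>R u t y"])
      (use K time_deriv_m in \<open>auto intro!: continuous_intros cont cont_R' cont_U'\<close>)
  have cont_q: "continuous_on ?K q"
  proof (rule continuous_on_eq)
    have "continuous_on ?K (\<lambda>y. U' y (u t y, 1))"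
    proof (rule continuous_on_linear_apply[where D = U'])
      show "linear (U' y)" if "y \<in> ?K" for y
        using K that by (intro has_derivative_linear[OF u']) auto
    qed (intro continuous_intros cont cont_U')+
    then show "continuous_on ?K (\<lambda>y. \<rho> t y *\<^sub>R U' y (u t y, 1))"
      by (intro continuous_intros cont)
  qed (use K q_eq in auto)
  \<comment> \<open>The continuity equation in conservative form, by the product rule for the
    divergence of \<open>\<rho> u\<close>.\<close>
  have divergence_m: "divergence (m t) y = - time_deriv \<rho> t y" if "y \<in> \<Omega>" for y
  proof -
    note \<rho>y = spacetime_has_derivativeD(1)[OF \<rho>'[OF that]]
    note component = bounded_linear.has_derivative[OF bounded_linear_vec_nth, THEN frechet_derivative_at, symmetric]
    have "divergence (u t) y = (\<Sum>j\<in>UNIV. U' y (axis j 1, 0) $ j)"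
      by (simp add: divergence_def partial_deriv_def
          component[OF spacetime_has_derivativeD(1)[OF u'[OF that]]])
    moreover have "u t y \<bullet> grad (\<rho> t) y = (\<Sum>j\<in>UNIV. u t y $ j * R' y (axis j 1, 0))"
      by (simp add: inner_vec_def grad_def partial_deriv_def frechet_derivative_at[OF \<rho>y, symmetric])
    moreover have "divergence (m t) y =
        (\<Sum>j\<in>UNIV. \<rho> t y * U' y (axis j 1, 0) $ j + R' y (axis j 1, 0) * u t y $ j)"
      by (simp add: divergence_def partial_deriv_def
          component[OF spacetime_has_derivativeD(1)[OF m'[OF that]]])
    ultimately show ?thesis
      using continuity[OF that \<open>t \<in> I\<close>]
      by (simp add: sum.distrib sum_distrib_left sum_negf mult.commute)
  qed
  define A0 where "A0 = filtered \<kappa> h w (\<rho> t) r"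
  define U where "U = uh t r"
  have "A0 > 0"
    unfolding A0_def
    by (rule filtered_pos[OF w supp]) (use assms K cont in auto)
  have A0_U: "A0 *\<^sub>R U = filtered \<kappa> h w (m t) r"
    using \<open>A0 > 0\<close> by (simp add: U_def uh favre_def A0_def m_def)
  define DA where "DA = (\<lambda>(v, \<sigma>). filtered \<kappa> h (\<lambda>z. frechet_derivative w (at z) v) (\<rho> t) r
        + \<sigma> *\<^sub>R filtered \<kappa> h w (time_deriv \<rho> t) r)"
  define DM where "DM = (\<lambda>(v, \<sigma>). filtered \<kappa> h (\<lambda>z. frechet_derivative w (at z) v) (m t) r
        + \<sigma> *\<^sub>R filtered \<kappa> h w (time_deriv m t) r)"
  have DA: "((\<lambda>(x, s). filtered \<kappa> h w (\<rho> s) x) has_derivative DA) (at (r, t))"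
    unfolding DA_def by (rule filtered_has_derivative[OF w supp \<rho>1 assms(5,6) K \<open>t \<in> I\<close>])
  have DM: "((\<lambda>(x, s). filtered \<kappa> h w (m s) x) has_derivative DM) (at (r, t))"
    unfolding DM_def by (rule filtered_has_derivative[OF w supp m1 assms(5,6) K \<open>t \<in> I\<close>])
  have uh_eq: "(\<lambda>(x, s). uh s x) = (\<lambda>z. inverse ((\<lambda>(x, s). filtered \<kappa> h w (\<rho> s) x) z) *\<^sub>R
      ((\<lambda>(x, s). filtered \<kappa> h w (m s) x) z))"
    by (auto simp: uh favre_def m_def)
  \<comment> \<open>The quotient rule for filtered momentum over filtered density, with the momentum
    at \<open>(r, t)\<close> written as \<open>A0 *\<^sub>R U\<close>.\<close>
  define DU where "DU v = inverse A0 *\<^sub>R DM v - (inverse A0 * DA v * inverse A0) *\<^sub>R (A0 *\<^sub>R U)" for v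
  have DU: "((\<lambda>(x, s). uh s x) has_derivative DU) (at (r, t))"
  proof -
    have "(\<lambda>(x, s). filtered \<kappa> h w (\<rho> s) x) (r, t) \<noteq> 0"
      using \<open>A0 > 0\<close> by (simp add: A0_def)
    from has_derivative_scaleR[OF Deriv.has_derivative_inverse[OF this DA] DM]
    show ?thesis
      unfolding uh_eq by (rule has_derivative_eq_rhs) (simp add: DU_def[abs_def] A0_def[symmetric] A0_U)
  qed
  have lhs: "A0 *\<^sub>R material_deriv uh uh t r = DM (U, 1) - DA (U, 1) *\<^sub>R U"
    using \<open>A0 > 0\<close> spacetime_has_derivativeD(4)[OF DU, of uh]
    by (simp add: DU_def U_def[symmetric] scaleR_diff_right)
  \<comment> \<open>With the direction as first argument, \<open>W v\<close> is itself a kernel that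
    can be passed to \<open>filtered\<close>.\<close>
  define W where "W v = (\<lambda>z. frechet_derivative w (at z) v)" for v
  note cont_W = continuous_on_kernel_derivative[OF w supp]
  have mass_flux: "(LINT y:?K|lborel. W (m t y) (r - y)) = - filtered \<kappa> h w (time_deriv \<rho> t) r"
  proof -
    have 1: "Ck_on (Suc 0) \<Omega> (\<lambda>_. 1 :: real)"
      by (rule Ck_on_Suc0I[OF has_derivative_const]) simp
    have "(LINT y:?K|lborel. W (m t y) (r - y) *\<^sub>R (1::real))
        = filtered \<kappa> h w (\<lambda>y. divergence (m t) y *\<^sub>R 1 + frechet_derivative (\<lambda>_. 1) (at y) (m t y)) r"
      unfolding W_def by (rule set_integral_kernel_derivative_flux[OF w supp slices(4) 1 assms(5) K])
    \<comment> \<open>The explicit zero lets \<open>filtered_diff\<close> pull out the sign.\<close>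
    also have "\<dots> = filtered \<kappa> h w (\<lambda>y. 0 - time_deriv \<rho> t y) r"
      using K divergence_m by (intro filtered_cong) (auto simp: frechet_derivative_const)
    also have "\<dots> = - filtered \<kappa> h w (time_deriv \<rho> t) r"
      by (subst filtered_diff[OF w supp continuous_on_const cont_time_deriv_\<rho>]) (simp_all add: filtered_def)
    finally show ?thesis by simp
  qed
  \<comment> \<open>The flux identity with \<open>g = u\<close>. The divergence of \<open>m\<close>
    produces minus the time derivative of \<open>\<rho>\<close> times \<open>u\<close>; the other
    term is the convective part of \<open>q\<close>. Adding and subtracting \<open>\<rho>\<close>
    times the time derivative of \<open>u\<close> completes these to \<open>q\<close> minus the time
    derivative of \<open>m\<close>.\<close>
  have momentum_flux: "(LINT y:?K|lborel. W (m t y) (r - y) *\<^sub>R u t y) =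
      filtered \<kappa> h w q r - filtered \<kappa> h w (time_deriv m t) r"
  proof -
    have "(LINT y:?K|lborel. W (m t y) (r - y) *\<^sub>R u t y)
        = filtered \<kappa> h w (\<lambda>y. divergence (m t) y *\<^sub>R u t y + frechet_derivative (u t) (at y) (m t y)) r"
      unfolding W_def by (rule set_integral_kernel_derivative_flux[OF w supp slices(4,2) assms(5) K])
    also have "\<dots> = filtered \<kappa> h w (\<lambda>y. q y - time_deriv m t y) r"
    proof (rule filtered_cong)
      fix y assume "y \<in> ?K"
      then have y: "y \<in> \<Omega>" using K by auto
      note lin = has_derivative_linear[OF u'[OF y]]
      have "frechet_derivative (u t) (at y) (m t y) = \<rho> t y *\<^sub>R U' y (u t y, 0)"
        using frechet_derivative_at[OF spacetime_has_derivativeD(1)[OF u'[OF y]], symmetric]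
          linear_cmul[OF lin, of "\<rho> t y" "(u t y, 0)"]
        by (simp add: m_def)
      moreover have "U' y (u t y, 1) = U' y (u t y, 0) + U' y (0, 1)"
        using linear_add[OF lin, of "(u t y, 0)" "(0, 1)"] by simp
      ultimately show "divergence (m t) y *\<^sub>R u t y + frechet_derivative (u t) (at y) (m t y)
          = q y - time_deriv m t y"
        using y by (simp add: divergence_m time_deriv_\<rho> time_deriv_m q_eq algebra_simps)
    qed
    also have "\<dots> = filtered \<kappa> h w q r - filtered \<kappa> h w (time_deriv m t) r"
      by (rule filtered_diff[OF w supp cont_q cont_time_deriv_m])
    finally show ?thesis .
  qed
  have forces: "filtered \<kappa> h w (tensor_divergence (\<tau> t)) r + \<rho>h t r *\<^sub>R bh t r = filtered \<kappa> h w q r"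
  proof -
    have "filtered \<kappa> h w (tensor_divergence (\<tau> t)) r = filtered \<kappa> h w (\<lambda>y. q y - \<rho> t y *\<^sub>R b t y) r"
      using K momentum \<open>t \<in> I\<close> by (intro filtered_cong) (auto simp: q_def)
    also have "\<dots> = filtered \<kappa> h w q r - filtered \<kappa> h w (\<lambda>y. \<rho> t y *\<^sub>R b t y) r"
      by (intro filtered_diff[OF w supp] continuous_intros cont_q cont)
    finally show ?thesis
      using \<open>A0 > 0\<close> by (simp add: bh favre_def \<rho>h A0_def)
  qed
  \<comment> \<open>Expand both factors \<open>U - u\<close>. Linearity of \<open>W\<close> in its
    direction absorbs the density, turning \<open>\<rho>\<close> times \<open>W u\<close> into
    \<open>W m\<close>.\<close>
  have "(LINT r':?K|lborel. \<rho> t r' *\<^sub>R (outer (U - u t r') (U - u t r') *v grad (\<lambda>x. w (x - r')) r))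
    = (LINT y:?K|lborel. (W U (r - y) *\<^sub>R \<rho> t y) *\<^sub>R U - W U (r - y) *\<^sub>R m t y
        - W (m t y) (r - y) *\<^sub>R U + W (m t y) (r - y) *\<^sub>R u t y)"
  proof (intro set_lebesgue_integral_cong allI impI)
    fix y
    have lin: "linear (\<lambda>v. W v (r - y))"
      unfolding W_def by (rule has_derivative_linear[OF kernel_has_derivative[OF w supp]])
    show "\<rho> t y *\<^sub>R (outer (U - u t y) (U - u t y) *v grad (\<lambda>x. w (x - y)) r)
        = (W U (r - y) *\<^sub>R \<rho> t y) *\<^sub>R U - W U (r - y) *\<^sub>R m t y
          - W (m t y) (r - y) *\<^sub>R U + W (m t y) (r - y) *\<^sub>R u t y"
      using linear_cmul[OF lin, of "\<rho> t y" "u t y"]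
      by (simp add: outer_mult_vec inner_grad_kernel[OF w supp] m_def W_def algebra_simps)
  qed (simp add: test_space_eq_cball)
  \<comment> \<open>The first two terms are the spatial parts of \<open>DA\<close> and
    \<open>DM\<close> along \<open>U\<close>; the last two are the fluxes computed above, which
    supply the time parts and the force \<open>q\<close>.\<close>
  also have "\<dots> = filtered \<kappa> h (W U) (\<rho> t) r *\<^sub>R U - filtered \<kappa> h (W U) (m t) r
      - (LINT y:?K|lborel. W (m t y) (r - y)) *\<^sub>R U + (LINT y:?K|lborel. W (m t y) (r - y) *\<^sub>R u t y)"
  proof -
    have W: "continuous_on ?K (\<lambda>y. W (v y) (r - y))" if "continuous_on ?K v" for v
      unfolding W_def using that by (intro cont_W continuous_intros)
    have c: "continuous_on ?K (\<lambda>y. W U (r - y) *\<^sub>R \<rho> t y)"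
      "continuous_on ?K (\<lambda>y. W (m t y) (r - y))"
      by (intro continuous_on_scaleR W cont continuous_on_const)+
    have i: "set_integrable lborel ?K (\<lambda>y. (W U (r - y) *\<^sub>R \<rho> t y) *\<^sub>R U)"
      "set_integrable lborel ?K (\<lambda>y. W U (r - y) *\<^sub>R m t y)"
      "set_integrable lborel ?K (\<lambda>y. W (m t y) (r - y) *\<^sub>R U)"
      "set_integrable lborel ?K (\<lambda>y. W (m t y) (r - y) *\<^sub>R u t y)"
      by (intro set_integrable_test_space continuous_on_scaleR W cont continuous_on_const)+
    show ?thesis
      unfolding filtered_def set_integral_test_space_scaleR_left[OF c(1), symmetric]
        set_integral_test_space_scaleR_left[OF c(2), symmetric]
      by (simp only: set_integral_add set_integral_diff i)
  qed
  finally have "(LINT r':?K|lborel. \<rho> t r' *\<^sub>R (outer (U - u t r') (U - u t r') *v grad (\<lambda>x. w (x - r')) r))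
    = filtered \<kappa> h w q r - (DM (U, 1) - DA (U, 1) *\<^sub>R U)"
    unfolding mass_flux momentum_flux by (simp add: DM_def DA_def W_def algebra_simps)
  then have "A0 *\<^sub>R material_deriv uh uh t r
      = - (LINT r':?K|lborel. \<rho> t r' *\<^sub>R (outer (U - u t r') (U - u t r') *v grad (\<lambda>x. w (x - r')) r))
        + (filtered \<kappa> h w (tensor_divergence (\<tau> t)) r + \<rho>h t r *\<^sub>R bh t r)"
    unfolding lhs forces by simp
  moreover have "A0 = \<rho>h t r"
    by (simp add: A0_def \<rho>h)
  ultimately show ?thesis
    using DU by (auto simp: differentiable_def U_def add.assoc)
qed

end
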